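(* Let $m\ge 23$ be an odd integer and let $u\in\mathbb{F}_{2^m}^*$. Then the function $C_u:\mathbb{F}_{2^m}^3\to\mathbb{F}_{2^m}^3$ given by $$C_u(X,Y,Z)=\big(X^3+uY^2Z,\ \ Y^3+uXZ^2,\ \ Z^3+uX^2Y\big)$$ is not a permutation of $\mathbb{F}_{2^m}^3$.
   Context: A function $\mathbb{F}_{2^m}^3\to\mathbb{F}_{2^m}^3$ is called a permutation if it is bijective. *)

theory Defs
  imports "HOL-Computational_Algebra.Primes" "HOL-Library.Cardinality"
begin

definition C :: "'a::comm_ring_1 \<Rightarrow> 'a \<times> 'a \<times> 'a \<Rightarrow> 'a \<times> 'a \<times> 'a" where
  "C u = (\<lambda>(X, Y, Z).
     (X ^ 3 + u * Y ^ 2 * Z,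
      Y ^ 3 + u * X * Z ^ 2,
      Z ^ 3 + u * X ^ 2 * Y))"

end

theory Submission
  imports Defs "HOL-Computational_Algebra.Polynomial" "HOL-Library.Product_Plus"
begin

text \<open>A fibre of \<open>C u\<close> is hard to control directly, but the pullback of a line under \<open>C u\<close> is a plane
  cubic \<open>E = p X^3 + q Y^3 + r Z^3 + u r X^2 Y + u p Y^2 Z + u q Z^2 X\<close>, and if \<open>C u\<close> is bijective,
  then the trace of \<open>E\<close> takes the values 0 and 1 equally often, for every choice of \<open>(p, q, r) \<noteq> 0\<close>.
  The proof finds a simple necessary condition for this and shows that it fails for some \<open>(p, q, r)\<close>.

  The trace of \<open>E\<close> is a quadratic form over the field with two elements. A balanced quadratic form cannot
  vanish on the radical of its polar form (\<open>balanced_quadratic_radical\<close>), so there is a radical vector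
  on which the trace of \<open>E\<close> is 1. The radical is described by three equations, which force \<open>E\<close> to take
  values in \<open>{0, 1}\<close> there; so \<open>E = 1\<close> at that vector (\<open>balanced_cubic_radical\<close>). If the invariant
  \<open>a3 = (1 + u^3) p q r\<close> is 1, then a polynomial identity in the coordinates of such a vector writes the
  invariant \<open>a4 = u^3 (p^3 q + q^3 r + r^3 p)\<close> as \<open>y^4 + y\<close> (\<open>a4_artin_schreier\<close>), whence \<open>a4\<close> has trace 0.

  If \<open>1 + u^3 = 0\<close>, an explicit collision exists. Otherwise put \<open>d = 1 + u^3\<close> and take \<open>p = 1\<close>,
  \<open>q = 1 / t\<close>, \<open>r = t / d\<close>. Then \<open>a4 = (u / d)^3 t^3 + u^3 / t + (u^3 / d) / t^2\<close> has trace 0 for every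
  \<open>t \<noteq> 0\<close>. As a function on the nonzero elements, this trace is a combination of distinct characters,
  in which \<open>t^3\<close> has coefficient \<open>(u / d)^3\<close>; so this coefficient is 0
  (\<open>trace_vanishing_leading_coeff\<close>), which is absurd.\<close>

section \<open>Characteristic two and the absolute trace\<close>

lemma char2_add_self:
  fixes x y :: "'a::comm_ring_1"
  assumes "(2::'a) = 0"
  shows "x + x = 0" "x + (x + y) = y"
proof -
  show *: "x + x = 0" using assms by (metis mult_2 mult_zero_left)
  show "x + (x + y) = y" using * by (metis add.assoc add_0)
qed

lemma char2_square_add:
  fixes x y :: "'a::comm_ring_1"
  assumes "(2::'a) = 0"
  shows "(x + y)^2 = x^2 + y^2"
  using assms by (simp add: power2_sum)

definition tr :: "nat \<Rightarrow> 'a::comm_ring_1 \<Rightarrow> 'a" where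
  "tr m x = (\<Sum>i<m. x ^ (2 ^ i))"

lemma card_gt_1: "1 < CARD('a::finite_field)"
  using card_mono[of UNIV "{0, 1 :: 'a}"] by simp

lemma two_eq_0:
  assumes "CARD('a::finite_field) = 2 ^ m"
  shows "(2::'a) = 0"
proof -
  have "m \<noteq> 0" using assms card_gt_1[where 'a = 'a] by (intro notI) simp
  then have "(-1::'a) ^ (2 ^ m) = 1" by simp
  then have "(-1::'a) = 1" using finite_field_power_card_eq_same[of "-1::'a"] assms by simp
  then show ?thesis by (metis one_add_one add.right_inverse)
qed

lemma char2_power_add:
  fixes x y :: "'a::comm_ring_1"
  assumes "(2::'a) = 0"
  shows "(x + y) ^ (2 ^ i) = x ^ (2 ^ i) + y ^ (2 ^ i)"
proof (induction i)
  case (Suc i)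
  then show ?case
    using char2_square_add[OF assms, of "x ^ (2 ^ i)" "y ^ (2 ^ i)"]
    by (simp add: mult.commute[of 2] power_mult)
qed simp

lemma tr_0 [simp]: "tr m 0 = 0"
  by (simp add: tr_def power_0_left)

lemma tr_add:
  assumes "(2::'a::comm_ring_1) = 0"
  shows "tr m (x + y :: 'a) = tr m x + tr m y"
  by (simp add: tr_def char2_power_add[OF assms] sum.distrib)

lemma tr_square:
  fixes x :: "'a::finite_field"
  assumes "CARD('a) = 2 ^ m"
  shows "tr m (x^2) = tr m x"
proof -
  have "tr m (x^2) = (\<Sum>i<m. x ^ (2 ^ Suc i))"
    by (simp add: tr_def power_mult)
  also have "\<dots> + x = tr m x + x ^ (2 ^ m)"
    using sum.lessThan_Suc_shift[of "\<lambda>i. x ^ (2 ^ i)" m]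
    by (simp add: tr_def)
  finally show ?thesis
    using finite_field_power_card_eq_same[of x] assms by simp
qed

lemma square_tr:
  fixes x :: "'a::comm_ring_1"
  assumes "(2::'a) = 0"
  shows "(tr m x)^2 = tr m (x^2)"
proof (induction m)
  case (Suc m)
  then show ?case
    by (simp add: tr_def char2_square_add[OF assms] power_mult[symmetric] mult.commute)
qed (simp add: tr_def)

lemma tr_cases:
  fixes x :: "'a::finite_field"
  assumes "CARD('a) = 2 ^ m"
  shows "tr m x = 0 \<or> tr m x = 1"
proof -
  have "tr m x * tr m x = tr m x"
    using square_tr[OF two_eq_0[OF assms], of m x] tr_square[OF assms, of x]
    by (simp add: power2_eq_square)
  then show ?thesis by simp
qed

lemma tr_1:
  assumes "(2::'a::comm_ring_1) = 0" "odd m"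
  shows "tr m (1::'a) = 1"
proof -
  obtain k where "m = 2 * k + 1" using assms(2) by (rule oddE)
  then show ?thesis using assms(1) by (simp add: tr_def)
qed

definition chi :: "nat \<Rightarrow> 'a::comm_ring_1 \<Rightarrow> int" where
  "chi m x = (if tr m x = 0 then 1 else -1)"

lemma chi_add:
  fixes x y :: "'a::finite_field"
  assumes "CARD('a) = 2 ^ m"
  shows "chi m (x + y) = chi m x * chi m y"
  using tr_cases[OF assms, of x] tr_cases[OF assms, of y] two_eq_0[OF assms]
  by (auto simp: chi_def tr_add[OF two_eq_0[OF assms]])

text \<open>Every element is a square, so a nonzero \<open>k\<close> has a multiple \<open>x^2 * k = 1\<close>, and 1 has trace 1 when the
  degree \<open>m\<close> is odd.\<close>

lemma trace_form_nondegenerate: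
  fixes k :: "'a::finite_field"
  assumes card: "CARD('a) = 2 ^ m" and "odd m"
    and 0: "\<And>x. tr m (x^2 * k) = 0"
  shows "k = 0"
proof (rule ccontr)
  assume "k \<noteq> 0"
  define x where "x = (1 / k) ^ (2 ^ (m - 1))"
  have "x^2 = (1 / k) ^ (2 ^ m)"
    using \<open>odd m\<close> unfolding x_def by (cases m) (simp_all add: mult.commute flip: power_mult)
  then have "x^2 * k = 1"
    using finite_field_power_card_eq_same[of "1 / k"] card \<open>k \<noteq> 0\<close> by simp
  then show False using 0[of x] tr_1[OF two_eq_0[OF card] \<open>odd m\<close>] by simp
qed

section \<open>Balanced quadratic forms\<close>

lemma sum_nontrivial_character:
  fixes f :: "'v::{finite,ab_group_add} \<Rightarrow> int"
  assumes hom: "\<And>v w. f (v + w) = f v * f w"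
    and nontriv: "f v0 = -1"
  shows "(\<Sum>v\<in>UNIV. f v) = 0"
proof -
  have "(\<Sum>v\<in>UNIV. f v) = (\<Sum>v\<in>UNIV. f (v + v0))"
    by (rule sum.reindex_bij_witness[of _ "\<lambda>v. v + v0" "\<lambda>v. v - v0"]) auto
  also have "\<dots> = - (\<Sum>v\<in>UNIV. f v)"
    by (simp add: hom nontriv sum_negf)
  finally show ?thesis by simp
qed

text \<open>Squaring the sum of \<open>f\<close> gives \<open>CARD('v)\<close> times the sum of \<open>f\<close> over the radical of the polar form \<open>b\<close>.
  If \<open>f\<close> were 1 on the whole radical, which contains 0, the square would be positive. Signs
  \<open>\<plusminus>1\<close> encode the two elements of the prime field.\<close>

lemma balanced_quadratic_radical:
  fixes f :: "'v::{finite,ab_group_add} \<Rightarrow> int" and b :: "'v \<Rightarrow> 'v \<Rightarrow> int"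
  assumes sign: "\<And>v. f v = 1 \<or> f v = -1"
    and polar: "\<And>v w. f (v + w) = f v * f w * b w v"
    and hom: "\<And>w v v'. b w (v + v') = b w v * b w v'"
    and bal: "(\<Sum>v\<in>UNIV. f v) = 0"
  shows "\<exists>w. (\<forall>v. b w v = 1) \<and> f w = -1"
proof (rule ccontr)
  assume "\<not> ?thesis"
  then have rad: "f w = 1" if "\<forall>v. b w v = 1" for w
    using sign that by blast
  have sq: "f v * f v = 1" for v using sign[of v] by auto
  have bsign: "b w v = 1 \<or> b w v = -1" for w v
    using polar[of v w] sign[of v] sign[of w] sign[of "v + w"] by auto
  have inner: "(\<Sum>v\<in>UNIV. b w v) * f w = (if \<forall>v. b w v = 1 then int CARD('v) else 0)" for w
  proof (cases "\<forall>v. b w v = 1")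
    case True
    then show ?thesis using rad by simp
  next
    case False
    then obtain v0 where "b w v0 = -1" using bsign by blast
    then show ?thesis using sum_nontrivial_character[of "b w"] hom False by auto
  qed
  \<comment> \<open>\<open>b 0 v = f 0\<close> is a sign independent of \<open>v\<close>, and additivity excludes \<open>-1\<close>.\<close>
  have "b 0 v = 1" for v
    using polar[of v 0] polar[of 0 0] hom[of 0 0 0] sign[of v] sign[of 0] bsign[of 0 0] by auto
  then have zero: "\<forall>v. b 0 v = 1" by blast
  have "0 = (\<Sum>v\<in>UNIV. f v * (\<Sum>w\<in>UNIV. f w))"
    using bal by simp
  also have "\<dots> = (\<Sum>v\<in>UNIV. f v * (\<Sum>w\<in>UNIV. f (v + w)))"
  proof (rule sum.cong[OF refl])
    fix v
    have "(\<Sum>w\<in>UNIV. f w) = (\<Sum>w\<in>UNIV. f (v + w))"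
      by (rule sum.reindex_bij_witness[of _ "\<lambda>w. v + w" "\<lambda>w. w - v"]) auto
    then show "f v * (\<Sum>w\<in>UNIV. f w) = f v * (\<Sum>w\<in>UNIV. f (v + w))" by simp
  qed
  also have "\<dots> = (\<Sum>v\<in>UNIV. \<Sum>w\<in>UNIV. b w v * f w)"
  proof -
    have "f v * f (v + w) = b w v * f w" for v w
      using sq[of v] by (simp add: polar)
    then show ?thesis by (simp add: sum_distrib_left)
  qed
  also have "\<dots> = (\<Sum>w\<in>UNIV. (\<Sum>v\<in>UNIV. b w v) * f w)"
    by (subst sum.swap) (simp add: sum_distrib_right)
  also have "\<dots> = (\<Sum>w\<in>UNIV. if \<forall>v. b w v = 1 then int CARD('v) else 0)"
    by (simp add: inner)
  also have "\<dots> \<ge> (\<Sum>w\<in>{0}. if \<forall>v. b w v = 1 then int CARD('v) else 0)"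
    by (rule sum_mono2) auto
  finally show False using zero by simp
qed

section \<open>Cubic forms without an XYZ term\<close>

definition cubic :: "'a::comm_ring_1 \<Rightarrow> 'a \<Rightarrow> 'a \<Rightarrow> 'a \<Rightarrow> 'a \<Rightarrow> 'a \<Rightarrow> 'a \<times> 'a \<times> 'a \<Rightarrow> 'a" where
  "cubic p q r a b c = (\<lambda>(X, Y, Z).
     p * X^3 + q * Y^3 + r * Z^3 + a * X^2 * Y + b * Y^2 * Z + c * Z^2 * X)"

text \<open>Since \<open>x\<close> and \<open>x^2\<close> have the same trace, the polar form of the trace of the cubic, as a function of one
  argument, can be rewritten as the trace of a linear form in the squares of the coordinates; its
  three coefficients are the radical equations. With \<open>\<pi> = (P, Q, R)\<close> and \<open>M\<close> the matrix of the linear map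
  from \<open>(X^2, Y^2, Z^2)\<close> to \<open>\<pi>\<close>, they say that the transpose of \<open>M\<close> sends \<open>(X, Y, Z)\<close> to the squares of
  \<open>\<pi>\<close>. Evaluating \<open>M\<close> as a bilinear form at \<open>(X, Y, Z)\<close> and its squares shows that the cubic equals its
  own square there.\<close>

lemma balanced_cubic_radical:
  fixes p q r a b c :: "'a::finite_field"
  assumes card: "CARD('a) = 2 ^ m" and "odd m"
    and bal: "(\<Sum>v\<in>UNIV. chi m (cubic p q r a b c v)) = 0"
  obtains X Y Z P Q R where
    "P = p * X^2 + c * Z^2" "Q = q * Y^2 + a * X^2" "R = r * Z^2 + b * Y^2"
    "P^2 = p * X + a * Y" "Q^2 = q * Y + b * Z" "R^2 = r * Z + c * X"
    "X * P + Y * Q + Z * R = 1"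
proof -
  note two = two_eq_0[OF card]
  note ch = char2_add_self[OF two]
  define D where "D = (\<lambda>(X, Y, Z) (x, y, z).
    x * (p * X^2 + c * Z^2) + y * (q * Y^2 + a * X^2) + z * (r * Z^2 + b * Y^2)
    + (x^2 * (p * X + a * Y) + y^2 * (q * Y + b * Z) + z^2 * (r * Z + c * X)))"
  have cubic_add: "cubic p q r a b c (v + w) = cubic p q r a b c v + cubic p q r a b c w + D w v" for v w
    by (cases v; cases w)
      (simp add: cubic_def D_def algebra_simps power2_eq_square power3_eq_cube ch)
  have D_add: "D w (v + v') = D w v + D w v'" for w v v'
    by (cases w; cases v; cases v')
      (simp add: D_def char2_square_add[OF two] algebra_simps)
  have "\<exists>w. (\<forall>v. chi m (D w v) = 1) \<and> chi m (cubic p q r a b c w) = -1"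
  proof (rule balanced_quadratic_radical)
    show "chi m (cubic p q r a b c v) = 1 \<or> chi m (cubic p q r a b c v) = -1" for v
      by (simp add: chi_def)
  qed (simp_all only: cubic_add D_add chi_add[OF card] bal)
  then obtain X Y Z where rad: "\<And>v. tr m (D (X, Y, Z) v) = 0"
    and E0: "tr m (cubic p q r a b c (X, Y, Z)) \<noteq> 0"
    by (auto simp: chi_def split: if_splits)
  \<comment> \<open>\<open>x * P\<close> and its square have the same trace, which merges the two terms into one.\<close>
  have absorb: "P^2 = k" if "\<And>x. tr m (x * P + x^2 * k) = 0" for P k :: 'a
  proof -
    have "tr m (x^2 * (P^2 + k)) = 0" for x
      using that[of x] tr_square[OF card, of "x * P"]
      by (simp add: tr_add[OF two] distrib_left power_mult_distrib)
    then have "P^2 + k = 0" using trace_form_nondegenerate[OF card \<open>odd m\<close>] by blast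
    then show ?thesis using ch(2)[of k "P^2"] by (simp add: add.commute)
  qed
  define P where "P = p * X^2 + c * Z^2"
  define Q where "Q = q * Y^2 + a * X^2"
  define R where "R = r * Z^2 + b * Y^2"
  have sqs: "P^2 = p * X + a * Y" "Q^2 = q * Y + b * Z" "R^2 = r * Z + c * X"
    using rad[of "(_, 0, 0)"] rad[of "(0, _, 0)"] rad[of "(0, 0, _)"]
    by (auto intro!: absorb simp: D_def P_def Q_def R_def)
  define E where "E = X * P + Y * Q + Z * R"
  have E: "E = cubic p q r a b c (X, Y, Z)"
    unfolding E_def P_def Q_def R_def cubic_def
    by (simp add: algebra_simps power2_eq_square power3_eq_cube)
  have "E^2 = X^2 * P^2 + Y^2 * Q^2 + Z^2 * R^2"
    unfolding E_def by (simp add: char2_square_add[OF two] power_mult_distrib)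
  also have "\<dots> = E"
    unfolding sqs E cubic_def by (simp add: algebra_simps power2_eq_square power3_eq_cube)
  finally have "E = 0 \<or> E = 1" by (simp add: power2_eq_square)
  then have "E = 1" using E0 E by auto
  then have "X * P + Y * Q + Z * R = 1" by (simp add: E_def)
  then show ?thesis by (rule that[OF P_def Q_def R_def sqs])
qed

section \<open>The invariant that obstructs balancedness\<close>

text \<open>The cubic \<open>E\<close> has no \<open>X Y Z\<close> term, so in characteristic 2 it is a form of a supersingular curve
  \<open>y^2 + a3 y = x^3 + a4 x + a6\<close>, with \<open>a3 = p q r + a b c\<close> and \<open>a4 = p b^2 c + q c^2 a + r a^2 b\<close>.
  The 3-division polynomial of that curve is \<open>x^4 + a3^2 x + a4^2\<close>. Over an algebraic closure the
  solutions of the radical equations with \<open>E = 1\<close> represent the vertices of the four triangles through the nine flexes, and the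
  triangles correspond to the roots \<open>x\<close>. Hence a rational vertex forces a rational root.
  For \<open>a3 = 1\<close> the root attached to a vertex is a cubic covariant
  of \<open>E\<close>, and the lemma exhibits its square root \<open>y\<close> explicitly.\<close>

lemma a4_artin_schreier:
  fixes p q r a b c X Y Z P Q R :: "'a::comm_ring_1"
  assumes two: "(2::'a) = 0"
    and det: "p * q * r + a * b * c = 1"
    and P: "P = p * X^2 + c * Z^2" and Q: "Q = q * Y^2 + a * X^2" and R: "R = r * Z^2 + b * Y^2"
    and P2: "P^2 = p * X + a * Y" and Q2: "Q^2 = q * Y + b * Z" and R2: "R^2 = r * Z + c * X"
    and E: "X * P + Y * Q + Z * R = 1"
  shows "\<exists>y. y^4 + y = p * b^2 * c + q * c^2 * a + r * a^2 * b"
proof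
  note ch = char2_add_self[OF two]
  note sq = char2_square_add[OF two] power_mult_distrib
  \<comment> \<open>The hypotheses make every polynomial in \<open>X, \<dots>, R\<close> a combination of squarefree monomials;
    \<open>x\<close> is the squarefree form of \<open>y^2\<close>.\<close>
  define y where "y = P * Q * R + a * X * R + b * Y * P + c * Z * Q"
  define x where "x = X * Y * Z + a*c*X*Q + p*b*X*R + q*c*Y*P + a*b*Y*R + b*c*Z*P + r*a*Z*Q"
  \<comment> \<open>\<open>(P, Q, R)\<close> is a matrix of determinant \<open>p q r + a b c = 1\<close> applied to \<open>(X^2, Y^2, Z^2)\<close>;
    the adjugate inverts it.\<close>
  have X2: "X^2 = q*r*P + b*c*Q + q*c*R"
  proof -
    have "q*r*P + b*c*Q + q*c*R = (p*q*r + a*b*c) * X^2"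
      unfolding P Q R by (simp add: algebra_simps ch)
    then show ?thesis by (simp add: det)
  qed
  have Y2: "Y^2 = a*r*P + p*r*Q + a*c*R"
  proof -
    have "a*r*P + p*r*Q + a*c*R = (p*q*r + a*b*c) * Y^2"
      unfolding P Q R by (simp add: algebra_simps ch)
    then show ?thesis by (simp add: det)
  qed
  have Z2: "Z^2 = a*b*P + p*b*Q + p*q*R"
  proof -
    have "a*b*P + p*b*Q + p*q*R = (p*q*r + a*b*c) * Z^2"
      unfolding P Q R by (simp add: algebra_simps ch)
    then show ?thesis by (simp add: det)
  qed
  have "y^2 = x"
  proof -
    have "y^2 = P^2 * Q^2 * R^2 + a^2 * X^2 * R^2 + b^2 * Y^2 * P^2 + c^2 * Z^2 * Q^2"
      unfolding y_def by (simp add: sq)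
    also have "\<dots> = (p*q*r + a*b*c) * (X * Y * Z) + (a*c*X*Q + p*b*X*R + q*c*Y*P + a*b*Y*R + b*c*Z*P + r*a*Z*Q)"
      unfolding P2 Q2 R2 unfolding P Q R by (simp add: algebra_simps power2_eq_square)
    finally show ?thesis by (simp add: det x_def add.assoc)
  qed
  moreover have "x^2 = y + (p * b^2 * c + q * c^2 * a + r * a^2 * b) * (X * P + Y * Q + Z * R)"
  proof -
    have PP: "P * P = p * X + a * Y" "Q * Q = q * Y + b * Z" "R * R = r * Z + c * X"
      using P2 Q2 R2 by (simp_all add: power2_eq_square)
    have PPw: "P * (P * w) = (p * X + a * Y) * w" "Q * (Q * w) = (q * Y + b * Z) * w" "R * (R * w) = (r * Z + c * X) * w" for w
      by (simp_all flip: PP add: mult.assoc)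
    \<comment> \<open>Squares of \<open>X, \<dots>, R\<close> are linear in these variables, so both sides reduce to polynomials free
      of squares; these differ by a multiple of \<open>p q r + a b c + 1 = 0\<close>, with cofactor \<open>?k\<close>.\<close>
    let ?k = "P*Q*R + P*Q*R*p*q*r + P*Q*R*a*b*c + X*P*p*b*b*c + X*P*q*a*c*c + X*P*r*a*a*b + X*R*p*q*r*a + X*R*a + X*R*a*a*b*c + Y*P*p*q*r*b + Y*P*a*b*b*c + Y*P*b + Y*Q*p*b*b*c + Y*Q*q*a*c*c + Y*Q*r*a*a*b + Z*Q*p*q*r*c + Z*Q*a*b*c*c + Z*Q*c + Z*R*p*b*b*c + Z*R*q*a*c*c + Z*R*r*a*a*b"
    have "x^2 = X^2 * Y^2 * Z^2 + a^2*c^2*X^2*Q^2 + p^2*b^2*X^2*R^2 + q^2*c^2*Y^2*P^2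
        + a^2*b^2*Y^2*R^2 + b^2*c^2*Z^2*P^2 + r^2*a^2*Z^2*Q^2"
      unfolding x_def by (simp add: sq)
    also have "\<dots> = y + (p * b^2 * c + q * c^2 * a + r * a^2 * b) * (X * P + Y * Q + Z * R)
        + (p*q*r + a*b*c + 1) * ?k"
      unfolding X2 Y2 Z2 y_def by (simp add: algebra_simps power2_eq_square PP PPw ch)
    finally show ?thesis by (simp add: det ch)
  qed
  ultimately have "y^4 = y + (p * b^2 * c + q * c^2 * a + r * a^2 * b)"
    using E power_mult[of y 2 2] by simp
  then show "y^4 + y = p * b^2 * c + q * c^2 * a + r * a^2 * b"
    by (simp add: ch ac_simps)
qed

lemma balanced_cubic_trace:
  fixes p q r a b c :: "'a::finite_field"
  assumes card: "CARD('a) = 2 ^ m" and "odd m"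
    and det: "p * q * r + a * b * c = 1"
    and bal: "(\<Sum>v\<in>UNIV. chi m (cubic p q r a b c v)) = 0"
  shows "tr m (p * b^2 * c + q * c^2 * a + r * a^2 * b) = 0"
proof -
  note two = two_eq_0[OF card]
  obtain X Y Z P Q R where
    "P = p * X^2 + c * Z^2" "Q = q * Y^2 + a * X^2" "R = r * Z^2 + b * Y^2"
    "P^2 = p * X + a * Y" "Q^2 = q * Y + b * Z" "R^2 = r * Z + c * X"
    "X * P + Y * Q + Z * R = 1"
    using balanced_cubic_radical[OF card \<open>odd m\<close> bal] .
  from a4_artin_schreier[OF two det this]
  obtain y where y: "y^4 + y = p * b^2 * c + q * c^2 * a + r * a^2 * b" by blast
  have "tr m (y^4 + y) = tr m y + tr m y"
    using tr_square[OF card, of "y^2"] tr_square[OF card, of y]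
    by (simp add: tr_add[OF two] flip: power_mult)
  then show ?thesis using y by (simp only: char2_add_self[OF two])
qed

section \<open>Power sums over the nonzero elements\<close>

text \<open>Substituting \<open>g * t\<close> for \<open>t\<close> multiplies the sum by \<open>g ^ n\<close>. Some \<open>g\<close> has \<open>g ^ n \<noteq> 1\<close>, because with
  \<open>n\<close> reduced to a positive remainder \<open>k < CARD('a) - 1\<close>, the polynomial \<open>x ^ k - 1\<close> has at most \<open>k\<close> roots.\<close>

lemma sum_powers_nonzero:
  assumes "\<not> CARD('a::finite_field) - 1 dvd n"
  shows "(\<Sum>t\<in>UNIV-{0::'a}. t ^ n) = 0"
proof -
  define N where "N = CARD('a) - 1"
  have N: "CARD('a) = Suc N" "card (UNIV - {0::'a}) = N"
    using zero_less_card_finite[where 'a = 'a] by (simp_all add: N_def card_Diff_singleton)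
  define k where "k = n mod N"
  have k: "0 < k" "k < N"
    using assms N card_gt_1[where 'a = 'a] by (auto simp: k_def N_def[symmetric] dvd_eq_mod_eq_0)
  have unit: "g ^ N = 1" if "g \<noteq> 0" for g :: 'a
    using finite_field_power_card_eq_same[of g] that by (simp add: N)
  have "\<exists>g::'a. g \<noteq> 0 \<and> g ^ n \<noteq> 1"
  proof (rule ccontr)
    assume none: "\<not> ?thesis"
    have all: "g ^ k = 1" if "g \<noteq> 0" for g :: 'a
    proof -
      have "n = N * (n div N) + k" by (simp add: k_def)
      then have "g ^ n = (g ^ N) ^ (n div N) * g ^ k" by (metis power_add power_mult)
      moreover have "g ^ n = 1" using none that by blast
      ultimately show ?thesis using unit[OF that] by simp
    qed
    define h :: "'a poly" where "h = monom 1 k - 1"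
    have deg: "degree h \<le> k"
      unfolding h_def by (intro degree_diff_le degree_monom_le) simp
    have "coeff h k = 1" using k by (simp add: h_def)
    then have "h \<noteq> 0" by auto
    have "N \<le> card {x. poly h x = 0}"
      unfolding N(2)[symmetric]
      by (rule card_mono) (auto simp: h_def poly_monom all)
    also have "\<dots> \<le> k"
      using card_poly_roots_bound[OF \<open>h \<noteq> 0\<close>] deg by simp
    finally show False using k by simp
  qed
  then obtain g :: 'a where g: "g \<noteq> 0" "g ^ n \<noteq> 1" by blast
  have "(\<Sum>t\<in>UNIV-{0::'a}. t ^ n) = (\<Sum>t\<in>UNIV-{0::'a}. (g * t) ^ n)"
    by (rule sum.reindex_bij_witness[of _ "\<lambda>t. g * t" "\<lambda>t. t / g"]) (use g in auto)
  also have "\<dots> = g ^ n * (\<Sum>t\<in>UNIV-{0::'a}. t ^ n)"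
    by (simp add: power_mult_distrib sum_distrib_left)
  finally show ?thesis using g by simp
qed

text \<open>The next two facts say that \<open>t ^ 3\<close> is not the same function, on the nonzero elements, as any of the
  other monomials \<open>t ^ (3 * 2 ^ i)\<close> and \<open>(1 / t) ^ (2 ^ j)\<close> in the expanded trace. The first fails for
  \<open>m = 3\<close>, where \<open>2 ^ 2 + 3 = 2 ^ 3 - 1\<close>.\<close>

lemma mersenne_not_dvd_power2_add_3:
  assumes "m \<ge> 4" and "j \<le> m"
  shows "\<not> (2 ^ m - 1 :: nat) dvd 2 ^ j + 3"
proof
  assume "(2 ^ m - 1 :: nat) dvd 2 ^ j + 3"
  then obtain c where c: "2 ^ j + 3 = (2 ^ m - 1) * (c::nat)" by (elim dvdE)
  have big: "(16::nat) \<le> 2 ^ m" using power_increasing[OF \<open>m \<ge> 4\<close>, of "2::nat"] by simp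
  have le: "(2::nat) ^ j \<le> 2 ^ m" using assms by simp
  have "c \<noteq> 0" using c by (intro notI) simp
  moreover have "c < 2"
  proof (rule ccontr)
    assume "\<not> c < 2"
    then have "(2 ^ m - 1) * 2 \<le> (2 ^ m - 1) * c" by (intro mult_le_mono2) simp
    then show False using c le big by linarith
  qed
  ultimately have "c = 1" by simp
  then have eq: "2 ^ j + 4 = (2 ^ m :: nat)" using c big by simp
  have "j \<ge> 3"
  proof (rule ccontr)
    assume "\<not> j \<ge> 3"
    then have "(2::nat) ^ j \<le> 2 ^ 2" by (intro power_increasing) auto
    then show False using eq big by simp
  qed
  then have "(2 ^ 3 :: nat) dvd 2 ^ j" "(2 ^ 3 :: nat) dvd 2 ^ m"
    using \<open>m \<ge> 4\<close> by (intro le_imp_power_dvd; simp)+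
  then have "(8::nat) dvd 4" using eq dvd_add_right_iff[of 8 "2 ^ j" "4::nat"] by simp
  then show False by simp
qed

lemma mersenne_not_dvd_thrice_smaller:
  assumes "m \<ge> 4" and "0 < i" and "i < m"
  shows "\<not> (2 ^ m - 1 :: nat) dvd 3 * (2 ^ i - 1)"
proof
  assume "(2 ^ m - 1 :: nat) dvd 3 * (2 ^ i - 1)"
  then obtain c where c: "3 * (2 ^ i - 1) = (2 ^ m - 1) * (c::nat)" by (elim dvdE)
  have big: "(16::nat) \<le> 2 ^ m" using power_increasing[OF \<open>m \<ge> 4\<close>, of "2::nat"] by simp
  have i2: "(2::nat) ^ i \<ge> 2" using power_increasing[of 1 i "2::nat"] assms by simp
  have le: "2 * (2::nat) ^ i \<le> 2 ^ m" using power_increasing[of "Suc i" m "2::nat"] assms by simp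
  have "c \<noteq> 0" using c i2 by (intro notI) simp
  moreover have "c < 2"
  proof (rule ccontr)
    assume "\<not> c < 2"
    then have "(2 ^ m - 1) * 2 \<le> (2 ^ m - 1) * c" by (intro mult_le_mono2) simp
    then show False using c le big by linarith
  qed
  ultimately have "c = 1" by simp
  then have eq: "3 * 2 ^ i = (2 ^ m + 2 :: nat)" using c big i2 by simp
  have "i \<ge> 2"
  proof (rule ccontr)
    assume "\<not> i \<ge> 2"
    then have "i = 1" using assms by simp
    then show False using eq big by simp
  qed
  then have "(2 ^ 2 :: nat) dvd 3 * 2 ^ i" "(2 ^ 2 :: nat) dvd 2 ^ m"
    using \<open>m \<ge> 4\<close> by (intro dvd_mult le_imp_power_dvd; simp)+
  then have "(4::nat) dvd 2" using eq dvd_add_right_iff[of 4 "2 ^ m" "2::nat"] by simp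
  then show False by simp
qed

text \<open>Multiply the trace by \<open>(1 / t) ^ 3\<close> and sum over all \<open>t \<noteq> 0\<close>: only the constant term \<open>k\<close> of the product
  survives, with multiplicity \<open>2 ^ m - 1\<close>, which is odd.\<close>

lemma trace_vanishing_leading_coeff:
  fixes k e f :: "'a::finite_field"
  assumes card: "CARD('a) = 2 ^ m" and "m \<ge> 4"
    and 0: "\<And>t. t \<noteq> 0 \<Longrightarrow> tr m (k * t^3 + e / t + f / t^2) = 0"
  shows "k = 0"
proof -
  note two = two_eq_0[OF card]
  define S :: "nat \<Rightarrow> 'a" where "S n = (\<Sum>t\<in>UNIV-{0}. t ^ n)" for n
  have S0: "S n = 0" if "\<not> 2 ^ m - 1 dvd n" for n
    using sum_powers_nonzero[where 'a = 'a] that card by (simp add: S_def)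
  have Sinv: "(\<Sum>t\<in>UNIV-{0}. (1 / t) ^ n) = S n" for n
    unfolding S_def by (rule sum.reindex_bij_witness[of _ "\<lambda>t. 1 / t" "\<lambda>t. 1 / t"]) auto
  have neg: "S (2 ^ j + 3) = 0" if "j \<le> m" for j
    using S0 mersenne_not_dvd_power2_add_3[OF \<open>m \<ge> 4\<close> that] by blast
  have pos: "S (3 * (2 ^ i - 1)) = 0" if "0 < i" "i < m" for i
    using S0 mersenne_not_dvd_thrice_smaller[OF \<open>m \<ge> 4\<close> that] by blast
  have "0 = (\<Sum>t\<in>UNIV-{0}. (1 / t) ^ 3 * tr m (k * t^3 + e / t + f / t^2))"
    using 0 by (intro sum.neutral[symmetric]) auto
  also have "\<dots> = (\<Sum>t\<in>UNIV-{0}. \<Sum>i<m. k ^ (2 ^ i) * t ^ (3 * (2 ^ i - 1))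
      + e ^ (2 ^ i) * (1 / t) ^ (2 ^ i + 3) + f ^ (2 ^ i) * (1 / t) ^ (2 ^ Suc i + 3))"
  proof (rule sum.cong[OF refl])
    fix t :: 'a assume "t \<in> UNIV - {0}"
    then have t: "t \<noteq> 0" by simp
    have "(1 / t) ^ 3 * (k * t^3 + e / t + f / t^2) ^ (2 ^ i) = k ^ (2 ^ i) * t ^ (3 * (2 ^ i - 1))
      + e ^ (2 ^ i) * (1 / t) ^ (2 ^ i + 3) + f ^ (2 ^ i) * (1 / t) ^ (2 ^ Suc i + 3)" for i
    proof -
      have "3 * 2 ^ i = 3 * (2 ^ i - 1) + (3::nat)"
        using one_le_power[of "2::nat" i] by linarith
      then have "(t^3) ^ (2 ^ i) = t ^ (3 * (2 ^ i - 1)) * t ^ 3"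
        by (metis power_add power_mult)
      then have "(k * t^3) ^ (2 ^ i) = k ^ (2 ^ i) * t ^ (3 * (2 ^ i - 1)) * t ^ 3"
        by (simp add: power_mult_distrib)
      moreover have "(f / t^2) ^ (2 ^ i) = f ^ (2 ^ i) * (1 / t) ^ (2 ^ Suc i)"
        by (simp add: power_divide flip: power_mult)
      moreover have "(e / t) ^ (2 ^ i) = e ^ (2 ^ i) * (1 / t) ^ (2 ^ i)"
        by (simp add: power_divide)
      ultimately show ?thesis
        using t by (simp add: char2_power_add[OF two] distrib_left power_add power_one_over mult.commute)
    qed
    then show "(1 / t) ^ 3 * tr m (k * t^3 + e / t + f / t^2) = (\<Sum>i<m. k ^ (2 ^ i) * t ^ (3 * (2 ^ i - 1))
      + e ^ (2 ^ i) * (1 / t) ^ (2 ^ i + 3) + f ^ (2 ^ i) * (1 / t) ^ (2 ^ Suc i + 3))"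
      unfolding tr_def sum_distrib_left by simp
  qed
  also have "\<dots> = (\<Sum>i<m. k ^ (2 ^ i) * S (3 * (2 ^ i - 1))
      + e ^ (2 ^ i) * S (2 ^ i + 3) + f ^ (2 ^ i) * S (2 ^ Suc i + 3))"
    by (subst sum.swap) (simp only: sum.distrib sum_distrib_left[symmetric] Sinv S_def[symmetric])
  also have "\<dots> = (\<Sum>i<m. if i = 0 then k * S 0 else 0)"
    by (rule sum.cong[OF refl]) (use neg pos in \<open>auto simp del: power_Suc\<close>)
  also have "\<dots> = k * S 0" using \<open>m \<ge> 4\<close> by (simp add: sum.delta)
  finally have "k * S 0 = 0" by simp
  moreover have "S 0 = -1"
  proof -
    have "S 0 = of_nat (2 ^ m - 1)" by (simp add: S_def card_Diff_singleton card)
    also have "\<dots> = 2 ^ m - 1" by (simp add: of_nat_diff)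
    also have "(2::'a) ^ m = 0" using two \<open>m \<ge> 4\<close> by simp
    finally show ?thesis by simp
  qed
  ultimately show ?thesis by simp
qed

section \<open>Applying the obstruction to C\<close>

text \<open>The cubic is a nonzero linear form composed with \<open>C u\<close>; a bijection does not change how often the
  linear form takes each value.\<close>

lemma balanced_if_bij_C:
  fixes u p q r :: "'a::finite_field"
  assumes card: "CARD('a) = 2 ^ m" and "odd m" and "bij (C u)" and "p \<noteq> 0"
  shows "(\<Sum>v\<in>UNIV. chi m (cubic p q r (u * r) (u * p) (u * q) v)) = 0"
proof -
  define lin where "lin = (\<lambda>(X, Y, Z). p * X + q * Y + r * Z)"
  have "cubic p q r (u * r) (u * p) (u * q) v = lin (C u v)" for v
    by (cases v) (simp add: cubic_def lin_def C_def algebra_simps)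
  then have "(\<Sum>v\<in>UNIV. chi m (cubic p q r (u * r) (u * p) (u * q) v)) = (\<Sum>v\<in>UNIV. chi m (lin (C u v)))"
    by simp
  also have "\<dots> = (\<Sum>v\<in>UNIV. chi m (lin v))"
    using \<open>bij (C u)\<close> by (rule sum.reindex_bij_betw)
  also have "\<dots> = 0"
  proof (rule sum_nontrivial_character)
    show "chi m (lin (v + w)) = chi m (lin v) * chi m (lin w)" for v w
      by (cases v; cases w) (simp add: lin_def algebra_simps flip: chi_add[OF card])
    show "chi m (lin (1 / p, 0, 0)) = -1"
      using \<open>p \<noteq> 0\<close> tr_1[OF two_eq_0[OF card] \<open>odd m\<close>] by (simp add: lin_def chi_def)
  qed
  finally show ?thesis .
qed

text \<open>For \<open>u^3 = 1\<close> the three cubics have the common zero \<open>(1, u^2, u)\<close>, which collides with the origin.\<close>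

lemma not_inj_C_if_cube_root:
  fixes u :: "'a::field"
  assumes "(2::'a) = 0" and "1 + u^3 = 0"
  shows "\<not> inj (C u)"
proof
  assume "inj (C u)"
  have s: "u * (u * u) = 1"
    using assms char2_add_self(2)[OF assms(1), of 1 "u^3"] by (simp add: power3_eq_cube mult.assoc)
  have s': "u * (u * (u * w)) = w" for w
    using arg_cong[OF s, of "\<lambda>x. x * w"] by (simp add: mult.assoc)
  have "C u (1, u^2, u) = C u (0, 0, 0)"
    by (simp add: assms(1) C_def power2_eq_square power3_eq_cube mult.assoc s s')
  from injD[OF \<open>inj (C u)\<close> this] show False by simp
qed

theorem theorem6p3:
  fixes u :: "'a::finite_field" and m :: nat
  assumes "CARD('a) = 2 ^ m"
    and "m \<ge> 23" and "odd m"
    and "u \<noteq> 0"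
  shows "\<not> bij (C u)"
proof
  assume bij: "bij (C u)"
  note card = assms(1)
  define d where "d = 1 + u^3"
  have "d \<noteq> 0"
    using bij not_inj_C_if_cube_root[OF two_eq_0[OF card], of u] by (auto simp: d_def bij_def)
  \<comment> \<open>The choice \<open>(p, q, r) = (1, 1 / t, t / d)\<close> makes \<open>a3 = d p q r\<close> equal to 1.\<close>
  have "tr m (u^3 / d^3 * t^3 + u^3 / t + (u^3 / d) / t^2) = 0" if "t \<noteq> 0" for t
  proof -
    let ?q = "1 / t" and ?r = "t / d"
    have "1 * ?q * ?r = 1 / d" "(u * ?r) * (u * 1) * (u * ?q) = u^3 / d"
      using that by (simp_all add: power3_eq_cube)
    then have det: "1 * ?q * ?r + (u * ?r) * (u * 1) * (u * ?q) = 1"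
      using \<open>d \<noteq> 0\<close> by (simp add: d_def flip: add_divide_distrib)
    have "1 * (u * 1)^2 * (u * ?q) = u^3 / t"
      by (simp add: power2_eq_square power3_eq_cube)
    moreover have "?q * (u * ?q)^2 * (u * ?r) = (u^3 / d) / t^2"
      using that by (simp add: power2_eq_square power3_eq_cube mult_ac)
    moreover have "?r * (u * ?r)^2 * (u * 1) = u^3 / d^3 * t^3"
      by (simp add: power2_eq_square power3_eq_cube mult_ac)
    ultimately have "1 * (u * 1)^2 * (u * ?q) + ?q * (u * ?q)^2 * (u * ?r) + ?r * (u * ?r)^2 * (u * 1)
        = u^3 / d^3 * t^3 + u^3 / t + (u^3 / d) / t^2"
      by (simp only: add_ac)
    with balanced_cubic_trace[OF card \<open>odd m\<close> det balanced_if_bij_C[OF card \<open>odd m\<close> bij]]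
    show ?thesis by simp
  qed
  then have "u^3 / d^3 = 0"
    using trace_vanishing_leading_coeff[OF card, of "u^3 / d^3" "u^3" "u^3 / d"] \<open>m \<ge> 23\<close> by simp
  then show False using \<open>u \<noteq> 0\<close> \<open>d \<noteq> 0\<close> by simp
qed
end
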